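(* Let $P_{XY}$ be a probability measure defined on $\mathcal{X}\times\mathcal{Y}$ with $|\mathcal{X}|=M<\infty$, such that $P_{X|Y}(x|y)>0$ for all $(x,y)\in\mathcal{X}\times\mathcal{Y}$. Then for all $\alpha\in(-\infty,0)$, $$\varepsilon_{X|Y}\ge\exp\left(\frac{1-\alpha}{\alpha}\Bigl[H_\alpha(X|Y)-\log(M-1)\Bigr]\right).$$
   Context: Logarithms have an arbitrary fixed base larger than 1 and $\exp$ is the inverse of $\log$, with $\log 0=-\infty$ and $\exp(-\infty)=0$. $(X,Y)\sim P_{XY}$, with $\mathcal{Y}$ an arbitrary observation space. For $\alpha\in(-\infty,0)$ (and $P_{X|Y}>0$ on the finite set $\mathcal{X}$) the Arimoto-R\'enyi conditional entropy of order $\alpha$ is $$H_\alpha(X|Y)=\frac{\alpha}{1-\alpha}\log\mathbb{E}\left[\Bigl(\sum_{x\in\mathcal{X}}P_{X|Y}^\alpha(x|Y)\Bigr)^{1/\alpha}\right],$$ the expectation being over $Y\sim P_Y$. The minimum error probability of guessing $X$ from $Y$ is $\varepsilon_{X|Y}=\min_{\mathcal{L}\colon\mathcal{Y}\to\mathcal{X}}\mathbb{P}[X\ne\mathcal{L}(Y)]=1-\mathbb{E}[\max_{x\in\mathcal{X}}P_{X|Y}(x|Y)]$. *)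

theory Defs
  imports "HOL-Probability.Probability"
begin

text \<open>Logarithm and exponential to base \<open>b\<close>, with \<open>log 0 = -\<infinity>\<close> and \<open>exp (-\<infinity>) = 0\<close>.
  These conventions matter when the alphabet has a single element.\<close>

definition elog :: "real \<Rightarrow> real \<Rightarrow> ereal" where
  "elog b x = (if x = 0 then -\<infinity> else ereal (log b x))"

definition eexp :: "real \<Rightarrow> ereal \<Rightarrow> ereal" where
  "eexp b z = (case z of ereal r \<Rightarrow> ereal (b powr r) | PInfty \<Rightarrow> \<infinity> | MInfty \<Rightarrow> 0)"

text \<open>A joint law of \<open>(X, Y)\<close> is a probability measure \<open>P\<close> on \<open>count_space A \<Otimes>\<^sub>M N\<close>, where \<open>A\<close> is
  the finite alphabet and \<open>N\<close> the observation space. \<open>W x y\<close> stands for \<open>P\<^sub>X\<^sub>|\<^sub>Y(x|y)\<close>;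
  a conditional distribution is determined by \<open>P\<close> only up to \<open>P\<^sub>Y\<close>-null sets of \<open>y\<close>, so it is
  given as a version \<open>W\<close> satisfying the defining property.\<close>

abbreviation obs_law :: "'y measure \<Rightarrow> ('x \<times> 'y) measure \<Rightarrow> 'y measure" where
  "obs_law N P \<equiv> distr P N snd"

definition cond_law_version ::
  "'x set \<Rightarrow> 'y measure \<Rightarrow> ('x \<times> 'y) measure \<Rightarrow> ('x \<Rightarrow> 'y \<Rightarrow> real) \<Rightarrow> bool" where
  "cond_law_version A N P W \<longleftrightarrow>
     (\<forall>x\<in>A. W x \<in> borel_measurable N) \<and>
     (\<forall>x\<in>A. \<forall>y\<in>space N. 0 \<le> W x y) \<and>
     (\<forall>y\<in>space N. (\<Sum>x\<in>A. W x y) = 1) \<and>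
     (\<forall>x\<in>A. \<forall>B\<in>sets N.
        measure P ({x} \<times> B) = (LINT y:B|obs_law N P. W x y))"

text \<open>Arimoto-Renyi conditional entropy of negative order \<open>\<alpha>\<close>, for \<open>W > 0\<close>. The integrand
  takes values in \<open>(0, 1]\<close>, so it is integrable.\<close>

definition arimoto_renyi ::
  "real \<Rightarrow> real \<Rightarrow> 'x set \<Rightarrow> 'y measure \<Rightarrow> ('x \<times> 'y) measure \<Rightarrow> ('x \<Rightarrow> 'y \<Rightarrow> real) \<Rightarrow> ereal" where
  "arimoto_renyi b \<alpha> A N P W =
     ereal (\<alpha> / (1 - \<alpha>)) *
     elog b (LINT y|obs_law N P. (\<Sum>x\<in>A. W x y powr \<alpha>) powr (1 / \<alpha>))"

text \<open>Minimum error probability over all (measurable) guessing rules. The infimum is attained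
  by a maximum a posteriori rule, so it is a minimum.\<close>

definition min_error :: "'x set \<Rightarrow> 'y measure \<Rightarrow> ('x \<times> 'y) measure \<Rightarrow> real" where
  "min_error A N P =
     (INF L \<in> N \<rightarrow>\<^sub>M count_space A. measure P {(x, y) \<in> space P. x \<noteq> L y})"

end

theory Submission
  imports Defs
begin

text \<open>Fix an observation \<open>y\<close> and a guess \<open>a\<close>, and let \<open>s = 1 - W a y\<close> be the conditional error
  probability. Dropping the term of \<open>a\<close> and applying the power mean inequality of order \<open>\<alpha> < 0\<close>
  to the remaining \<open>M - 1\<close> terms gives
  \<open>(\<Sum>x. W x y powr \<alpha>) powr (1/\<alpha>) \<le> (M - 1) powr (1/\<alpha> - 1) * s\<close>.
  Integrating over \<open>y\<close> with \<open>a = L y\<close> bounds the error of every guessing rule \<open>L\<close>.\<close>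

lemma eexp_minus_infinity: "eexp b (- \<infinity>) = 0"
  by (simp add: eexp_def)

text \<open>The left side is the tangent at \<open>t = 1\<close> of the convex function
  \<open>t powr \<alpha>\<close>. Combining \<open>ln t \<le> t - 1\<close>, reversed by the factor
  \<open>\<alpha> < 0\<close>, with \<open>exp u \<ge> 1 + u\<close> avoids derivatives.\<close>

lemma powr_neg_ge_tangent:
  fixes t \<alpha> :: real
  assumes "0 < t" "\<alpha> < 0"
  shows "1 + \<alpha> * (t - 1) \<le> t powr \<alpha>"
proof -
  have "\<alpha> * (t - 1) \<le> \<alpha> * ln t"
    using assms by (intro mult_left_mono_neg ln_le_minus_one) auto
  also have "1 + \<alpha> * ln t \<le> t powr \<alpha>"
    using assms exp_ge_add_one_self[of "\<alpha> * ln t"] by (simp add: powr_def)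
  finally show ?thesis by simp
qed

text \<open>Jensen's inequality for the convex function \<open>t powr \<alpha>\<close>: after
  division by the mean \<open>m\<close>, each term lies above the tangent at 1.\<close>

lemma sum_powr_neg_ge:
  fixes w :: "'a \<Rightarrow> real"
  assumes "finite B" "B \<noteq> {}" "\<And>x. x \<in> B \<Longrightarrow> 0 < w x" "\<alpha> < 0"
  shows "real (card B) * (sum w B / card B) powr \<alpha> \<le> (\<Sum>x\<in>B. w x powr \<alpha>)"
proof -
  define m where "m = sum w B / card B"
  have card: "0 < real (card B)" using assms by (simp add: card_gt_0_iff)
  have m: "0 < m" unfolding m_def using assms card by (intro divide_pos_pos sum_pos) auto
  \<comment> \<open>The linear parts of the tangents cancel, since the deviations of
    \<open>w x / m\<close> from 1 sum to zero.\<close>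
  have "real (card B) = (\<Sum>x\<in>B. 1 + \<alpha> * (w x / m - 1))"
  proof -
    have "(\<Sum>x\<in>B. w x / m) = sum w B / m" by (simp add: sum_divide_distrib)
    also have "\<dots> = card B" using m card by (simp add: m_def field_simps)
    finally show ?thesis
      by (simp add: sum.distrib sum_subtractf flip: sum_distrib_left)
  qed
  also have "\<dots> \<le> (\<Sum>x\<in>B. (w x / m) powr \<alpha>)"
    using assms m by (intro sum_mono powr_neg_ge_tangent) auto
  also have "\<dots> = (\<Sum>x\<in>B. w x powr \<alpha>) / m powr \<alpha>"
    using assms m by (simp add: powr_divide less_imp_le sum_divide_distrib)
  finally show ?thesis
    using m by (simp add: m_def[symmetric] field_simps)
qed

lemma powr_sum_powr_neg_le:
  fixes w :: "'a \<Rightarrow> real"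
  assumes A: "finite A" "a \<in> A" "2 \<le> card A" and w: "\<And>x. x \<in> A \<Longrightarrow> 0 < w x" and \<alpha>: "\<alpha> < 0"
  shows "(real (card A) - 1) powr (1 - 1 / \<alpha>) * (\<Sum>x\<in>A. w x powr \<alpha>) powr (1 / \<alpha>)
    \<le> (\<Sum>x\<in>A - {a}. w x)"
proof -
  define n where "n = real (card A) - 1"
  define s where "s = (\<Sum>x\<in>A - {a}. w x)"
  \<comment> \<open>At least two symbols are needed here: some symbol other than \<open>a\<close>
    must remain.\<close>
  have n: "real (card (A - {a})) = n" "0 < n" using A by (auto simp: n_def)
  then have ne: "A - {a} \<noteq> {}" by force
  have s: "0 < s" unfolding s_def using A ne w by (intro sum_pos) auto
  have "n * (s / n) powr \<alpha> \<le> (\<Sum>x\<in>A - {a}. w x powr \<alpha>)"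
    using sum_powr_neg_ge[of "A - {a}" w \<alpha>] A ne w \<alpha> n by (simp add: s_def)
  also have "\<dots> \<le> (\<Sum>x\<in>A. w x powr \<alpha>)"
    using A by (intro sum_mono2) auto
  \<comment> \<open>The exponent \<open>1 / \<alpha>\<close> is negative, so the lower bound on the
    sum becomes an upper bound.\<close>
  finally have "(\<Sum>x\<in>A. w x powr \<alpha>) powr (1 / \<alpha>) \<le> (n * (s / n) powr \<alpha>) powr (1 / \<alpha>)"
    using n s \<alpha> by (intro powr_mono2') auto
  also have "\<dots> = n powr (1 / \<alpha>) * (s / n)"
    using n s \<alpha> by (simp add: powr_mult powr_powr)
  finally have "n powr (1 - 1 / \<alpha>) * (\<Sum>x\<in>A. w x powr \<alpha>) powr (1 / \<alpha>)
      \<le> n powr (1 - 1 / \<alpha>) * (n powr (1 / \<alpha>) * (s / n))"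
    by (intro mult_left_mono) auto
  also have "\<dots> = s" using n by (simp add: powr_diff)
  finally show ?thesis by (simp add: n_def s_def)
qed

lemma prob_space_obs_law:
  assumes "prob_space P" "sets P = sets (count_space A \<Otimes>\<^sub>M N)"
  shows "prob_space (obs_law N P)"
proof -
  have "snd \<in> P \<rightarrow>\<^sub>M N"
    unfolding measurable_cong_sets[OF assms(2) refl] by (rule measurable_snd)
  with assms(1) show ?thesis by (rule prob_space.prob_space_distr)
qed

lemma cond_law_le_one:
  assumes "finite A" "cond_law_version A N P W" "x \<in> A" "y \<in> space N"
  shows "W x y \<le> 1"
proof -
  have "W x y \<le> (\<Sum>x\<in>A. W x y)"
    using assms by (intro member_le_sum) (auto simp: cond_law_version_def)
  then show ?thesis using assms by (simp add: cond_law_version_def)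
qed

text \<open>Splitting the error event by the true symbol \<open>x\<close> gives disjoint rectangles
  \<open>{x} \<times> B x\<close>, whose probabilities are given by the defining property of
  \<open>W\<close>. Exchanging the finite sum with the integral leaves, at each \<open>y\<close>,
  the mass of all symbols other than \<open>L y\<close>.\<close>

lemma
  assumes A: "finite A" and P: "prob_space P" "sets P = sets (count_space A \<Otimes>\<^sub>M N)"
    and W: "cond_law_version A N P W" and L: "L \<in> N \<rightarrow>\<^sub>M count_space A"
  shows error_prob_eq_integral:
      "measure P {(x, y) \<in> space P. x \<noteq> L y} = (LINT y|obs_law N P. (\<Sum>x\<in>A - {L y}. W x y))"
    and integrable_cond_error: "integrable (obs_law N P) (\<lambda>y. \<Sum>x\<in>A - {L y}. W x y)"
proof -
  interpret P: prob_space P by fact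
  interpret Q: prob_space "obs_law N P" using P by (rule prob_space_obs_law)
  \<comment> \<open>The observations at which the rule misses \<open>x\<close>.\<close>
  define B where "B x = {y \<in> space N. L y \<noteq> x}" for x
  have B: "B x \<in> sets N" if "x \<in> A" for x
  proof -
    have "B x = L -` (A - {x}) \<inter> space N"
      using measurable_space[OF L] by (auto simp: B_def)
    then show ?thesis using measurable_sets[OF L, of "A - {x}"] by simp
  qed
  have meas: "W x \<in> borel_measurable N" if "x \<in> A" for x
    using W that by (simp add: cond_law_version_def)
  have int: "integrable (obs_law N P) (\<lambda>y. indicator (B x) y *\<^sub>R W x y)" if x: "x \<in> A" for x
  proof (rule Q.integrable_const_bound[where B = 1])
    show "AE y in obs_law N P. norm (indicator (B x) y *\<^sub>R W x y) \<le> 1"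
      using cond_law_le_one[OF A W x] W x
      by (intro AE_I2) (auto simp: indicator_def cond_law_version_def)
    show "(\<lambda>y. indicator (B x) y *\<^sub>R W x y) \<in> borel_measurable (obs_law N P)"
      using B[OF x] meas[OF x] by simp
  qed
  have sum_eq: "(\<Sum>x\<in>A. indicator (B x) y *\<^sub>R W x y) = (\<Sum>x\<in>A - {L y}. W x y)"
    if "y \<in> space N" for y
  proof -
    have "(\<Sum>x\<in>A. indicator (B x) y *\<^sub>R W x y) = (\<Sum>x\<in>A. if x \<noteq> L y then W x y else 0)"
      using that by (intro sum.cong) (auto simp: B_def)
    also have "\<dots> = (\<Sum>x\<in>A - {L y}. W x y)"
      using A by (simp add: sum.If_cases Diff_eq Collect_neg_eq)
    finally show ?thesis .
  qed
  have space: "space P = A \<times> space N"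
    using sets_eq_imp_space_eq[OF P(2)] by (simp add: space_pair_measure)
  have "{(x, y) \<in> space P. x \<noteq> L y} = (\<Union>x\<in>A. {x} \<times> B x)"
    using space by (auto simp: B_def)
  then have "measure P {(x, y) \<in> space P. x \<noteq> L y} = (\<Sum>x\<in>A. measure P ({x} \<times> B x))"
    using A B P(2) by (auto intro!: P.finite_measure_finite_Union pair_measureI
        simp: disjoint_family_on_def)
  also have "\<dots> = (\<Sum>x\<in>A. LINT y:B x|obs_law N P. W x y)"
    using W B by (simp add: cond_law_version_def)
  also have "\<dots> = (LINT y|obs_law N P. (\<Sum>x\<in>A. indicator (B x) y *\<^sub>R W x y))"
    unfolding set_lebesgue_integral_def using int by (rule Bochner_Integration.integral_sum[symmetric])
  also have "\<dots> = (LINT y|obs_law N P. (\<Sum>x\<in>A - {L y}. W x y))"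
    by (rule Bochner_Integration.integral_cong) (simp_all add: sum_eq del: real_scaleR_def)
  finally show "measure P {(x, y) \<in> space P. x \<noteq> L y} = (LINT y|obs_law N P. (\<Sum>x\<in>A - {L y}. W x y))" .
  have "integrable (obs_law N P) (\<lambda>y. \<Sum>x\<in>A. indicator (B x) y *\<^sub>R W x y)"
    using int by (rule Bochner_Integration.integrable_sum)
  then show "integrable (obs_law N P) (\<lambda>y. \<Sum>x\<in>A - {L y}. W x y)"
    by (subst Bochner_Integration.integrable_cong[OF refl, symmetric]) (simp_all add: sum_eq del: real_scaleR_def)
qed

text \<open>The integrand lies in \<open>(0, 1]\<close>. Positivity of its integral ensures that the
  logarithm in the entropy is finite.\<close>

lemma
  assumes A: "finite A" "A \<noteq> {}" and P: "prob_space P" "sets P = sets (count_space A \<Otimes>\<^sub>M N)"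
    and W: "cond_law_version A N P W" and pos: "\<And>x y. x \<in> A \<Longrightarrow> y \<in> space N \<Longrightarrow> 0 < W x y"
    and \<alpha>: "\<alpha> < 0"
  shows integrable_arimoto:
      "integrable (obs_law N P) (\<lambda>y. (\<Sum>x\<in>A. W x y powr \<alpha>) powr (1 / \<alpha>))"
    and integral_arimoto_pos:
      "0 < (LINT y|obs_law N P. (\<Sum>x\<in>A. W x y powr \<alpha>) powr (1 / \<alpha>))"
proof -
  interpret Q: prob_space "obs_law N P" using P by (rule prob_space_obs_law)
  let ?f = "\<lambda>y. (\<Sum>x\<in>A. W x y powr \<alpha>) powr (1 / \<alpha>)"
  have meas: "W x \<in> borel_measurable N" if "x \<in> A" for x
    using W that by (simp add: cond_law_version_def)
  have f_pos: "0 < ?f y" if "y \<in> space N" for y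
  proof -
    have "0 < (\<Sum>x\<in>A. W x y powr \<alpha>)"
      using A pos[OF _ that] by (intro sum_pos) (auto simp: less_imp_neq[symmetric])
    then show ?thesis by simp
  qed
  have f_le: "?f y \<le> 1" if y: "y \<in> space N" for y
  proof -
    \<comment> \<open>Any single symbol gives the bound: keeping only its term in the sum and
      applying the decreasing power \<open>1 / \<alpha>\<close> yields
      \<open>?f y \<le> W a y\<close>.\<close>
    obtain a where a: "a \<in> A" using A by blast
    have "W a y powr \<alpha> \<le> (\<Sum>x\<in>A. W x y powr \<alpha>)"
      using A a by (intro member_le_sum) auto
    then have "?f y \<le> (W a y powr \<alpha>) powr (1 / \<alpha>)"
      using pos[OF a y] \<alpha> by (intro powr_mono2') auto
    also have "\<dots> = W a y" using pos[OF a y] \<alpha> by (simp add: powr_powr)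
    also have "\<dots> \<le> 1" using A(1) W a y by (rule cond_law_le_one)
    finally show ?thesis .
  qed
  show int: "integrable (obs_law N P) ?f"
  proof (rule Q.integrable_const_bound[where B = 1])
    show "AE y in obs_law N P. norm (?f y) \<le> 1"
      using f_le by (intro AE_I2) auto
    show "?f \<in> borel_measurable (obs_law N P)"
      using meas by simp
  qed
  have "0 \<le> (LINT y|obs_law N P. ?f y)" by (rule Bochner_Integration.integral_nonneg) simp
  moreover have "(LINT y|obs_law N P. ?f y) \<noteq> 0"
  \<comment> \<open>A nonnegative function with zero integral vanishes almost everywhere, which
    pointwise positivity excludes on a probability space.\<close>
  proof
    assume "(LINT y|obs_law N P. ?f y) = 0"
    then have "AE y in obs_law N P. ?f y = 0"
      using integral_nonneg_eq_0_iff_AE[OF int] by simp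
    moreover have "AE y in obs_law N P. ?f y \<noteq> 0"
      using f_pos by (intro AE_I2) (metis less_irrefl space_distr)
    ultimately have "AE y in obs_law N P. False" by eventually_elim simp
    then show False by simp
  qed
  ultimately show "0 < (LINT y|obs_law N P. ?f y)" by linarith
qed

theorem theorem6:
  fixes b \<alpha> :: real and M :: nat
    and A :: "'x set" and N :: "'y measure"
    and P :: "('x \<times> 'y) measure" and W :: "'x \<Rightarrow> 'y \<Rightarrow> real"
  assumes base: "1 < b"
    and alphabet: "finite A" "card A = M"
    and joint: "prob_space P" "sets P = sets (count_space A \<Otimes>\<^sub>M N)"
    and cond: "cond_law_version A N P W"
    and pos: "\<And>x y. x \<in> A \<Longrightarrow> y \<in> space N \<Longrightarrow> 0 < W x y"
    and order: "\<alpha> < 0"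
  shows "ereal (min_error A N P) \<ge>
    eexp b (ereal ((1 - \<alpha>) / \<alpha>) *
      (arimoto_renyi b \<alpha> A N P W - elog b (real M - 1)))"
proof -
  interpret P: prob_space P by fact
  interpret Q: prob_space "obs_law N P" using joint by (rule prob_space_obs_law)
  let ?f = "\<lambda>y. (\<Sum>x\<in>A. W x y powr \<alpha>) powr (1 / \<alpha>)"
  define E where "E = (LINT y|obs_law N P. ?f y)"
  have "space P = A \<times> space N"
    using sets_eq_imp_space_eq[OF joint(2)] by (simp add: space_pair_measure)
  then have A: "A \<noteq> {}" using P.not_empty by auto
  then obtain a where a: "a \<in> A" by blast
  then have "(\<lambda>_. a) \<in> N \<rightarrow>\<^sub>M count_space A" by simp
  \<comment> \<open>Constant guesses make the set of rules nonempty, so bounding every rule from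
    below bounds the infimum.\<close>
  then have rules: "N \<rightarrow>\<^sub>M count_space A \<noteq> {}" by blast
  have int: "integrable (obs_law N P) ?f" and E: "0 < E"
    using integrable_arimoto[OF alphabet(1) A joint cond pos order]
      integral_arimoto_pos[OF alphabet(1) A joint cond pos order] by (auto simp: E_def)
  have entropy: "arimoto_renyi b \<alpha> A N P W = ereal (\<alpha> / (1 - \<alpha>) * log b E)"
    using E unfolding arimoto_renyi_def elog_def E_def[symmetric] by simp
  have "M \<noteq> 0" using alphabet A by auto
  then consider "M = 1" | "2 \<le> M" by linarith
  then show ?thesis
  proof cases
    case 1
    \<comment> \<open>With one symbol, \<open>elog b 0 = -\<infinity>\<close> makes the difference
      \<open>+\<infinity>\<close>. The negative factor turns it into \<open>-\<infinity>\<close>, so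
      the claimed bound is 0.\<close>
    have "(1 - \<alpha>) / \<alpha> < 0" using order by (simp add: divide_less_0_iff)
    then have "ereal ((1 - \<alpha>) / \<alpha>) * (arimoto_renyi b \<alpha> A N P W - elog b (real M - 1)) = - \<infinity>"
      using 1 order by (simp add: entropy elog_def)
    moreover have "0 \<le> min_error A N P"
      unfolding min_error_def using rules by (intro cINF_greatest) auto
    ultimately show ?thesis by (simp only: eexp_minus_infinity) simp
  next
    case 2
    \<comment> \<open>The factor \<open>(1 - \<alpha>) / \<alpha> = 1 / \<alpha> - 1\<close> cancels
      the prefactor of the entropy and gives \<open>M - 1\<close> the exponent
      \<open>1 - 1 / \<alpha>\<close>. The claimed bound is thus \<open>c * E\<close>.\<close>
    define c where "c = (real M - 1) powr (1 - 1 / \<alpha>)"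
    have c: "0 < c" using 2 by (simp add: c_def)
    have "(1 - \<alpha>) / \<alpha> * (\<alpha> / (1 - \<alpha>) * log b E - log b (real M - 1))
        = log b E + (1 - 1 / \<alpha>) * log b (real M - 1)"
      using order by (simp add: field_simps)
    also have "\<dots> = log b (c * E)"
      using 2 E by (simp add: c_def log_mult log_powr)
    finally have "eexp b (ereal ((1 - \<alpha>) / \<alpha>) * (arimoto_renyi b \<alpha> A N P W - elog b (real M - 1)))
        = ereal (c * E)"
      using 2 base c E by (simp add: entropy elog_def eexp_def)
    moreover have "c * E \<le> min_error A N P"
      unfolding min_error_def
    proof (rule cINF_greatest[OF rules])
      fix L assume L: "L \<in> N \<rightarrow>\<^sub>M count_space A"
      have "c * E = (LINT y|obs_law N P. c * ?f y)" by (simp add: E_def)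
      also have "\<dots> \<le> (LINT y|obs_law N P. (\<Sum>x\<in>A - {L y}. W x y))"
      proof (rule integral_mono)
        show "integrable (obs_law N P) (\<lambda>y. c * ?f y)" using int by simp
        show "integrable (obs_law N P) (\<lambda>y. \<Sum>x\<in>A - {L y}. W x y)"
          using alphabet(1) joint cond L by (rule integrable_cond_error)
        fix y assume "y \<in> space (obs_law N P)"
        then have y: "y \<in> space N" by simp
        then have "L y \<in> A" using measurable_space[OF L] by simp
        \<comment> \<open>The dropped symbol is the guess \<open>L y\<close>, so the remaining mass
          is the conditional error probability at \<open>y\<close>.\<close>
        then show "c * ?f y \<le> (\<Sum>x\<in>A - {L y}. W x y)"
          using powr_sum_powr_neg_le[of A "L y" "\<lambda>x. W x y" \<alpha>] alphabet 2 pos[OF _ y] order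
          by (simp add: c_def)
      qed
      also have "\<dots> = measure P {(x, y) \<in> space P. x \<noteq> L y}"
        using alphabet(1) joint cond L by (rule error_prob_eq_integral[symmetric])
      finally show "c * E \<le> measure P {(x, y) \<in> space P. x \<noteq> L y}" .
    qed
    ultimately show ?thesis by simp
  qed
qed

end
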